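(* Let $m\ge n\ge 1$, $A\in\mathbb{R}^{m\times n}$, and let $b\in\mathbb{R}^m$ lie in the column space of $A$. Then the system of linear equations $Ax=b$ has exactly one solution $x\in\mathbb{R}^n$ if and only if $\mathrm{Gdet}(A)\ne 0$. In this case, the solution $x=(x_i)_{i=1}^n$ is given by $$x_i=\frac{\mathrm{Gdet}(A_i)}{\mathrm{Gdet}(A)},\qquad 1\le i\le n,$$ where $A_i=(Ae_1,\dots,Ae_{i-1},b,Ae_{i+1},\dots,Ae_n)$ is the matrix obtained from $A$ by replacing its $i$-th column by $b$.
   Context: All matrices are real. Let $m\ge n\ge 1$. $S_m$ is the symmetric group on $\{1,\dots,m\}$ with identity element $(1)$. For $\sigma\in S_m$ let $\Phi(\sigma)$ be the $m\times m$ permutation matrix whose $i$-th row is $e_{\sigma(i)}^T$ ($e_j$ = $j$-th column of $I_m$), let $I_{m\times n}=(e_1,\dots,e_n)$, and $P_\sigma=\Phi(\sigma)I_{m\times n}\in\mathbb{R}^{m\times n}$. For $A\in\mathbb{R}^{m\times n}$ put $A^\sigma=P_\sigma^TA\in\mathbb{R}^{n\times n}$ (so the $j$-th row of $A^\sigma$ is the $\sigma^{-1}(j)$-th row of $A$). Totally order $S_m$ by: $\sigma>\tau$ iff there is $t$ with $\sigma(t)>\tau(t)$ and $\sigma(j)=\tau(j)$ for all $j>t$. Let $\sigma_A=(1)$ if $A$ is not of full column rank, and otherwise $\sigma_A=\max\{\sigma\in S_m:\det(A^\sigma)\neq 0\}$. The principal submatrix of $A$ is $A_P=A^{\sigma_A}$,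 and $\mathrm{sign}(A)\in\{1,0,-1\}$ is the sign of the real number $\det(A_P)$. The generalized determinant of $A\in\mathbb{R}^{m\times n}$ with $m\ge n$ is $$\mathrm{Gdet}(A)=\mathrm{sign}(A)\Big(\sum_{1\le i_1<\dots<i_n\le m}\det(A_{i_1,\dots,i_n})^2\Big)^{1/2},$$ where $A_{i_1,\dots,i_n}$ is the $n\times n$ submatrix formed by rows $i_1,\dots,i_n$ of $A$. (In $Ae_j$ in the claim, $e_j$ is the $j$-th standard basis vector of $\mathbb{R}^n$.) *)

theory Defs
  imports "Jordan_Normal_Form.DL_Rank_Submatrix"
begin

text \<open>
  Rows, columns and permuted points are numbered from 0, as in the matrix library: the symmetric
  group of degree \<open>m\<close> is \<open>{\<sigma>. \<sigma> permutes {..<m}}\<close>. The shift by one from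
  \<open>{1, \<dots>, m}\<close> affects neither the order on permutations nor the order of the rows of a submatrix.
\<close>

definition perm_matrix :: "nat \<Rightarrow> (nat \<Rightarrow> nat) \<Rightarrow> real mat" where
  "perm_matrix m \<sigma> = mat_of_rows m (map (\<lambda>i. unit_vec m (\<sigma> i)) [0..<m])"

definition rect_one_mat :: "nat \<Rightarrow> nat \<Rightarrow> real mat" where
  "rect_one_mat m n = mat_of_cols m (map (unit_vec m) [0..<n])"

definition perm_mat_rect :: "nat \<Rightarrow> nat \<Rightarrow> (nat \<Rightarrow> nat) \<Rightarrow> real mat" where
  "perm_mat_rect m n \<sigma> = perm_matrix m \<sigma> * rect_one_mat m n"

text \<open>The square matrix \<open>A\<^sup>\<sigma>\<close>; its \<open>j\<close>-th row is row \<open>inv \<sigma> j\<close> of \<open>A\<close>.\<close>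

definition perm_submatrix :: "(nat \<Rightarrow> nat) \<Rightarrow> real mat \<Rightarrow> real mat" where
  "perm_submatrix \<sigma> A = transpose_mat (perm_mat_rect (dim_row A) (dim_col A) \<sigma>) * A"

definition perm_less :: "nat \<Rightarrow> (nat \<Rightarrow> nat) \<Rightarrow> (nat \<Rightarrow> nat) \<Rightarrow> bool" where
  "perm_less m \<tau> \<sigma> \<longleftrightarrow> (\<exists>t<m. \<tau> t < \<sigma> t \<and> (\<forall>j. t < j \<and> j < m \<longrightarrow> \<sigma> j = \<tau> j))"

definition full_column_rank :: "real mat \<Rightarrow> bool" where
  "full_column_rank A \<longleftrightarrow> vec_space.rank (dim_row A) A = dim_col A"

definition nonsing_perms :: "real mat \<Rightarrow> (nat \<Rightarrow> nat) set" where
  "nonsing_perms A = {\<sigma>. \<sigma> permutes {..<dim_row A} \<and> det (perm_submatrix \<sigma> A) \<noteq> 0}"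

text \<open>
  The description operator picks the maximum with respect to \<^const>\<open>perm_less\<close>. It is unique because
  the order is total on permutations, and it exists because a matrix of full column rank has
  a nonsingular square submatrix formed by rows.
\<close>

definition principal_perm :: "real mat \<Rightarrow> nat \<Rightarrow> nat" where
  "principal_perm A =
     (if full_column_rank A
      then (THE \<sigma>. \<sigma> \<in> nonsing_perms A \<and>
              (\<forall>\<tau>\<in>nonsing_perms A. \<tau> \<noteq> \<sigma> \<longrightarrow> perm_less (dim_row A) \<tau> \<sigma>))
      else id)"

definition principal_submatrix :: "real mat \<Rightarrow> real mat" where
  "principal_submatrix A = perm_submatrix (principal_perm A) A"

definition mat_sign :: "real mat \<Rightarrow> real" where
  "mat_sign A = sgn (det (principal_submatrix A))"

text \<open>
  The index sets \<open>I\<close> stand for the increasing index sequences: \<^const>\<open>submatrix\<close> lists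
  the selected rows in increasing order.
\<close>

definition Gdet :: "real mat \<Rightarrow> real" where
  "Gdet A = mat_sign A *
     sqrt (\<Sum>I | I \<subseteq> {..<dim_row A} \<and> card I = dim_col A. (det (submatrix A I UNIV))\<^sup>2)"

end

theory Submission
  imports Defs
begin

text \<open>
  If \<open>A x = b\<close>, then \<open>A\<^sub>i = A X\<^sub>i\<close> with \<open>X\<^sub>i\<close> the identity matrix whose \<open>i\<close>-th column is
  replaced by \<open>x\<close>, and \<open>det X\<^sub>i = x\<^sub>i\<close>. Right multiplication by a square matrix \<open>B\<close> multiplies
  every maximal minor by \<open>det B\<close>; for \<open>det B \<noteq> 0\<close> it also preserves which minors vanish, hence
  the principal permutation. Thus \<open>Gdet (A B) = Gdet A det B\<close>, which is Cramer's rule.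
  Moreover, \<open>Gdet A \<noteq> 0\<close> iff some maximal minor is nonzero iff \<open>A\<close> has trivial kernel.
\<close>

section \<open>Entries of the permutation matrices and rows of \<open>perm_submatrix\<close>\<close>

lemma perm_matrix_carrier: "perm_matrix m \<sigma> \<in> carrier_mat m m"
  by (auto simp: perm_matrix_def)

lemma rect_one_mat_carrier: "rect_one_mat m n \<in> carrier_mat m n"
  by (auto simp: rect_one_mat_def)

lemma perm_mat_rect_carrier: "perm_mat_rect m n \<sigma> \<in> carrier_mat m n"
  unfolding perm_mat_rect_def
  by (rule mult_carrier_mat[OF perm_matrix_carrier rect_one_mat_carrier])

lemma perm_matrix_index:
  assumes "i < m" "j < m"
  shows "perm_matrix m \<sigma> $$ (i, j) = (if j = \<sigma> i then 1 else 0)"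
  using assms by (auto simp: perm_matrix_def mat_of_rows_index unit_vec_def)

lemma perm_mat_rect_index:
  assumes "\<sigma> permutes {..<m}" "i < m" "j < n" "n \<le> m"
  shows "perm_mat_rect m n \<sigma> $$ (i, j) = (if \<sigma> i = j then 1 else 0)"
proof -
  have s: "\<sigma> i < m"
    using permutes_in_image[OF assms(1), of i] assms(2) by simp
  have R: "rect_one_mat m n $$ (k, j) = (if k = j then 1 else 0)" if "k < m" for k
    using assms that by (simp add: rect_one_mat_def mat_of_cols_index unit_vec_def)
  have "perm_mat_rect m n \<sigma> $$ (i, j) =
      (\<Sum>k = 0..<m. perm_matrix m \<sigma> $$ (i, k) * rect_one_mat m n $$ (k, j))"
    using assms perm_matrix_carrier[of m \<sigma>] rect_one_mat_carrier[of m n]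
    by (simp add: perm_mat_rect_def scalar_prod_def)
  also have "\<dots> = (\<Sum>k = 0..<m. if k = \<sigma> i then (if k = j then 1 else 0) else 0)"
    using assms by (intro sum.cong) (auto simp: perm_matrix_index R)
  also have "\<dots> = (if \<sigma> i = j then 1 else 0)"
    using s by simp
  finally show ?thesis .
qed

lemma perm_submatrix_eq:
  assumes A: "A \<in> carrier_mat m n" and "n \<le> m" and p: "\<sigma> permutes {..<m}"
  shows "perm_submatrix \<sigma> A = mat n n (\<lambda>(i, j). A $$ (inv_into UNIV \<sigma> i, j))"
proof (rule eq_matI)
  note dim = perm_mat_rect_carrier[of m n \<sigma>]
  fix i j assume "i < dim_row (mat n n (\<lambda>(i, j). A $$ (inv_into UNIV \<sigma> i, j)))"
    "j < dim_col (mat n n (\<lambda>(i, j). A $$ (inv_into UNIV \<sigma> i, j)))"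
  hence ij: "i < n" "j < n" by simp_all
  have s: "inv_into UNIV \<sigma> i < m"
    using permutes_in_image[OF permutes_inv[OF p], of i] ij \<open>n \<le> m\<close> by simp
  have "perm_submatrix \<sigma> A $$ (i, j) =
      (\<Sum>k = 0..<m. perm_mat_rect m n \<sigma> $$ (k, i) * A $$ (k, j))"
    using A dim ij by (simp add: perm_submatrix_def scalar_prod_def)
  also have "\<dots> = (\<Sum>k = 0..<m. if k = inv_into UNIV \<sigma> i then A $$ (k, j) else 0)"
    using ij \<open>n \<le> m\<close> permutes_inverses[OF p]
    by (intro sum.cong) (auto simp: perm_mat_rect_index[OF p])
  also have "\<dots> = A $$ (inv_into UNIV \<sigma> i, j)"
    using s by simp
  finally show "perm_submatrix \<sigma> A $$ (i, j) = mat n n (\<lambda>(i, j). A $$ (inv_into UNIV \<sigma> i, j)) $$ (i, j)"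
    using ij by simp
qed (use A in \<open>auto simp: perm_submatrix_def perm_mat_rect_def rect_one_mat_def\<close>)

lemma perm_submatrix_carrier:
  assumes "A \<in> carrier_mat m n"
  shows "perm_submatrix \<sigma> A \<in> carrier_mat n n"
  using assms by (auto simp: perm_submatrix_def perm_mat_rect_def rect_one_mat_def)

lemma perm_submatrix_mult:
  assumes A: "A \<in> carrier_mat m n" and B: "B \<in> carrier_mat n n"
  shows "perm_submatrix \<sigma> (A * B) = perm_submatrix \<sigma> A * B"
proof -
  have "transpose_mat (perm_mat_rect m n \<sigma>) \<in> carrier_mat n m"
    using perm_mat_rect_carrier by simp
  thus ?thesis
    using A B assoc_mult_mat[OF _ A B] by (simp add: perm_submatrix_def)
qed

section \<open>Square submatrices formed by sets of rows\<close>

lemma submatrix_rows_carrier: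
  assumes "A \<in> carrier_mat m n" "I \<subseteq> {..<m}" "card I = k"
  shows "submatrix A I UNIV \<in> carrier_mat k n"
proof -
  have "{i. i < m \<and> i \<in> I} = I" using assms by auto
  thus ?thesis using assms by (auto simp: dim_submatrix intro!: carrier_matI)
qed

lemma row_submatrix_rows:
  assumes "A \<in> carrier_mat m n" "I \<subseteq> {..<m}" "i < card I"
  shows "row (submatrix A I UNIV) i = row A (pick I i)"
proof -
  have "{i. i < m \<and> i \<in> I} = I" using assms by auto
  thus ?thesis using assms by (intro row_submatrix_UNIV) auto
qed

text \<open>\<open>pick I\<close> is strictly increasing on these indices, hence injective, and
  counting gives surjectivity. This turns statements about the numbered rows of a submatrix into
  statements about the set \<open>I\<close>.\<close>

lemma pick_image_card:
  assumes "finite I"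
  shows "pick I ` {..<card I} = I"
proof (rule card_subset_eq[OF assms])
  show "pick I ` {..<card I} \<subseteq> I"
    using pick_in_set_le by auto
  have "inj_on (pick I) {..<card I}"
    by (rule linorder_inj_onI') (use pick_mono_le in force)
  thus "card (pick I ` {..<card I}) = card I"
    by (simp add: card_image)
qed

lemma submatrix_rows_mult:
  assumes A: "A \<in> carrier_mat m n" and B: "B \<in> carrier_mat n k" and I: "I \<subseteq> {..<m}"
  shows "submatrix (A * B) I UNIV = submatrix A I UNIV * B"
proof (rule eq_matI)
  have AB: "A * B \<in> carrier_mat m k" using A B by simp
  note cA = submatrix_rows_carrier[OF A I refl] and cAB = submatrix_rows_carrier[OF AB I refl]
  have fin: "finite I" using I finite_subset by blast
  show "dim_row (submatrix (A * B) I UNIV) = dim_row (submatrix A I UNIV * B)"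
    "dim_col (submatrix (A * B) I UNIV) = dim_col (submatrix A I UNIV * B)"
    using cA cAB B by auto
  fix i j assume "i < dim_row (submatrix A I UNIV * B)" "j < dim_col (submatrix A I UNIV * B)"
  hence ij: "i < card I" "j < k" using cA B by auto
  have pk: "pick I i < m"
    using pick_in_set_le[OF ij(1)] I by auto
  have "submatrix (A * B) I UNIV $$ (i, j) = row (submatrix (A * B) I UNIV) i $ j"
    using cAB ij by simp
  also have "\<dots> = row A (pick I i) \<bullet> col B j"
    using A B ij pk by (simp add: row_submatrix_rows[OF AB I])
  also have "\<dots> = (submatrix A I UNIV * B) $$ (i, j)"
    using cA B ij by (simp add: row_submatrix_rows[OF A I])
  finally show "submatrix (A * B) I UNIV $$ (i, j) = (submatrix A I UNIV * B) $$ (i, j)" .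
qed

section \<open>Separating sets of rows and nonvanishing determinants\<close>

text \<open>The rows in \<open>I\<close>, read as linear forms, have only the trivial common zero.
  The condition ignores the order of the rows, so it treats \<open>submatrix\<close>, which lists
  them increasingly, and \<open>perm_submatrix\<close>, which permutes them, alike.\<close>

definition rows_separate :: "'a :: semiring_0 mat \<Rightarrow> nat set \<Rightarrow> bool" where
  "rows_separate A I \<longleftrightarrow>
     (\<forall>v\<in>carrier_vec (dim_col A). (\<forall>k\<in>I. row A k \<bullet> v = 0) \<longrightarrow> v = 0\<^sub>v (dim_col A))"

text \<open>The kernel of \<open>B\<close> consists of the common zeros of the selected rows of
  \<open>A\<close>, and over a domain a square matrix is singular iff its kernel is nontrivial. The
  map \<open>f\<close> will be \<open>pick I\<close> or an inverse permutation.\<close>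

lemma det_nonzero_iff_rows_separate:
  fixes A B :: "'a :: idom mat"
  assumes A: "A \<in> carrier_mat m n" and B: "B \<in> carrier_mat n n"
    and rows: "\<And>i. i < n \<Longrightarrow> row B i = row A (f i)"
  shows "det B \<noteq> 0 \<longleftrightarrow> rows_separate A (f ` {..<n})"
proof -
  have "B *\<^sub>v v = 0\<^sub>v n \<longleftrightarrow> (\<forall>k\<in>f ` {..<n}. row A k \<bullet> v = 0)" for v
    using B by (auto simp: vec_eq_iff rows)
  thus ?thesis
    using A by (auto simp: det_0_iff_vec_prod_zero[OF B] rows_separate_def)
qed

lemma det_submatrix_nonzero_iff:
  fixes A :: "'a :: idom mat"
  assumes A: "A \<in> carrier_mat m n" and I: "I \<subseteq> {..<m}" "card I = n"
  shows "det (submatrix A I UNIV) \<noteq> 0 \<longleftrightarrow> rows_separate A I"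
proof -
  have "finite I" using I finite_subset by blast
  thus ?thesis
    using det_nonzero_iff_rows_separate[OF A submatrix_rows_carrier[OF A I], of "pick I"]
      row_submatrix_rows[OF A I(1)] pick_image_card I by auto
qed

lemma det_perm_submatrix_nonzero_iff:
  assumes A: "A \<in> carrier_mat m n" and "n \<le> m" and p: "\<sigma> permutes {..<m}"
  shows "det (perm_submatrix \<sigma> A) \<noteq> 0 \<longleftrightarrow> rows_separate A (inv_into UNIV \<sigma> ` {..<n})"
proof (rule det_nonzero_iff_rows_separate[OF A perm_submatrix_carrier[OF A]])
  fix i assume "i < n"
  moreover have "inv_into UNIV \<sigma> i < m"
    using permutes_in_image[OF permutes_inv[OF p], of i] \<open>i < n\<close> \<open>n \<le> m\<close> by simp
  ultimately show "row (perm_submatrix \<sigma> A) i = row A (inv_into UNIV \<sigma> i)"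
    using A by (auto simp: perm_submatrix_eq[OF A \<open>n \<le> m\<close> p] intro!: eq_vecI)
qed

text \<open>Bridge from the index sets in \<open>Gdet\<close> to the permutations in
  \<open>nonsing_perms\<close>: enumerate \<open>I\<close> by the first \<open>n\<close> positions
  and its complement by the others, then glue.\<close>

lemma permutes_inv_image_eq:
  assumes I: "I \<subseteq> {..<m}" "card I = n"
  obtains \<sigma> where "\<sigma> permutes {..<m}" "inv_into UNIV \<sigma> ` {..<n} = I"
proof -
  have fin: "finite I" using I finite_subset by blast
  have nm: "n \<le> m" using card_mono[OF _ I(1)] I(2) by simp
  obtain f where f: "bij_betw f {..<n} I"
    using fin I finite_same_card_bij[of "{..<n}" I] by auto
  have "card {n..<m} = card ({..<m} - I)"
    using fin I by (simp add: card_Diff_subset)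
  then obtain g where g: "bij_betw g {n..<m} ({..<m} - I)"
    using finite_same_card_bij[of "{n..<m}" "{..<m} - I"] by auto
  define p where "p i = (if i < n then f i else if i < m then g i else i)" for i
  have "bij_betw p {..<n} I"
    using f by (subst bij_betw_cong[where g = f]) (auto simp: p_def)
  moreover have "bij_betw p {n..<m} ({..<m} - I)"
    using g by (subst bij_betw_cong[where g = g]) (auto simp: p_def)
  ultimately have "bij_betw p ({..<n} \<union> {n..<m}) (I \<union> ({..<m} - I))"
    by (intro bij_betw_combine) auto
  moreover have "{..<n} \<union> {n..<m} = {..<m}" "I \<union> ({..<m} - I) = {..<m}"
    using nm I by auto
  ultimately have p: "p permutes {..<m}"
    using nm by (intro bij_imp_permutes) (auto simp: p_def)
  have "p ` {..<n} = I"
    using \<open>bij_betw p {..<n} I\<close> by (simp add: bij_betw_def)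
  \<comment> \<open>\<open>p\<close> sends positions to rows, whereas \<open>perm_submatrix\<close>
    reads row \<open>j\<close> through the inverse of its permutation; so the witness is the inverse
    of \<open>p\<close>.\<close>
  thus thesis
    using that[OF permutes_inv[OF p]] permutes_inv_inv[OF p] by simp
qed

section \<open>Existence of a nonsingular maximal minor\<close>

text \<open>Padding \<open>B\<close> with zero rows gives a square matrix \<open>C\<close> of
  determinant 0. A kernel vector of \<open>C\<close> is one of \<open>B\<close>, because the first
  \<open>k\<close> rows agree.\<close>

lemma wide_matrix_kernel:
  fixes B :: "'a :: idom mat"
  assumes B: "B \<in> carrier_mat k n" and "k < n"
  obtains v where "v \<in> carrier_vec n" "v \<noteq> 0\<^sub>v n" "B *\<^sub>v v = 0\<^sub>v k"
proof -
  define C where "C = mat n n (\<lambda>(i, j). if i < k then B $$ (i, j) else 0)"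
  have C: "C \<in> carrier_mat n n" by (simp add: C_def)
  \<comment> \<open>Row \<open>k\<close> of \<open>C\<close> is the first padded row; transposed, it
    becomes a zero column, so the unit vector at \<open>k\<close> is a kernel vector.\<close>
  have "transpose_mat C *\<^sub>v unit_vec n k = 0\<^sub>v n"
    using \<open>k < n\<close> by (auto simp: vec_eq_iff C_def)
  moreover have "unit_vec n k \<noteq> (0\<^sub>v n :: 'a vec)"
    using \<open>k < n\<close> by simp
  ultimately have "det (transpose_mat C) = 0"
    using C by (subst det_0_iff_vec_prod_zero[where n = n]) (auto intro!: exI[of _ "unit_vec n k"])
  hence "det C = 0" using det_transpose[OF C] by simp
  then obtain v where v: "v \<in> carrier_vec n" "v \<noteq> 0\<^sub>v n" "C *\<^sub>v v = 0\<^sub>v n"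
    using det_0_iff_vec_prod_zero[OF C] by auto
  have "(B *\<^sub>v v) $ i = 0" if "i < k" for i
  proof -
    have "row B i = row C i"
      using that B \<open>k < n\<close> by (auto simp: C_def intro!: eq_vecI)
    hence "(B *\<^sub>v v) $ i = (C *\<^sub>v v) $ i"
      using that B C \<open>k < n\<close> by simp
    thus ?thesis using v that \<open>k < n\<close> by simp
  qed
  hence "B *\<^sub>v v = 0\<^sub>v k" using B by auto
  thus thesis using that v by blast
qed

text \<open>A minimal separating set \<open>J\<close> of rows works: \<open>|J| < n\<close> leaves a wide matrix with
  a kernel, while minimality yields vectors dual to the rows in \<open>J\<close>, so \<open>|J| > n\<close> would give \<open>|J|\<close>
  linearly independent vectors of length \<open>n\<close>.\<close>

lemma rows_separate_imp_minor:
  fixes A :: "'a :: idom mat"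
  assumes A: "A \<in> carrier_mat m n" and sep: "rows_separate A {..<m}"
  obtains I where "I \<subseteq> {..<m}" "card I = n" "rows_separate A I"
proof -
  let ?P = "\<lambda>J. J \<subseteq> {..<m} \<and> rows_separate A J"
  have "\<exists>J. ?P J \<and> (\<forall>K. ?P K \<longrightarrow> card J \<le> card K)"
    using sep ex_has_least_nat[of ?P "{..<m}" card] by auto
  then obtain J where J: "J \<subseteq> {..<m}" "rows_separate A J"
    and min: "\<And>K. K \<subseteq> {..<m} \<Longrightarrow> rows_separate A K \<Longrightarrow> card J \<le> card K"
    by blast
  have fin: "finite J" using J finite_subset by blast
  have "\<not> card J < n"
  proof
    assume "card J < n"
    then obtain v where v: "v \<in> carrier_vec n" "v \<noteq> 0\<^sub>v n"
      and 0: "submatrix A J UNIV *\<^sub>v v = 0\<^sub>v (card J)"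
      using wide_matrix_kernel[OF submatrix_rows_carrier[OF A J(1) refl]] by metis
    have "row A (pick J i) \<bullet> v = 0" if "i < card J" for i
      using arg_cong[OF 0, of "\<lambda>w. w $ i"] that submatrix_rows_carrier[OF A J(1) refl]
      by (simp add: row_submatrix_rows[OF A J(1)])
    hence "\<forall>k\<in>J. row A k \<bullet> v = 0"
      using pick_image_card[OF fin] by (metis imageE lessThan_iff)
    thus False using J(2) v A by (auto simp: rows_separate_def)
  qed
  moreover have "\<not> n < card J"
  proof
    assume less: "n < card J"
    have "\<exists>v\<in>carrier_vec n. (\<forall>k\<in>J - {j}. row A k \<bullet> v = 0) \<and> row A j \<bullet> v \<noteq> 0" if "j \<in> J" for j
    proof -
      have "card (J - {j}) < card J" using that fin by (meson card_Diff1_less)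
      hence "\<not> rows_separate A (J - {j})"
        using min[of "J - {j}"] J(1) by force
      then obtain v where v: "v \<in> carrier_vec n" "\<forall>k\<in>J - {j}. row A k \<bullet> v = 0" "v \<noteq> 0\<^sub>v n"
        using A by (auto simp: rows_separate_def)
      have "row A j \<bullet> v \<noteq> 0"
      proof
        assume "row A j \<bullet> v = 0"
        hence "\<forall>k\<in>J. row A k \<bullet> v = 0" using v(2) by blast
        thus False using J(2) A v(1,3) by (simp add: rows_separate_def)
      qed
      thus ?thesis using v by blast
    qed
    then obtain d where d: "\<forall>j\<in>J. d j \<in> carrier_vec n \<and>
        (\<forall>k\<in>J - {j}. row A k \<bullet> d j = 0) \<and> row A j \<bullet> d j \<noteq> 0"
      unfolding Bex_def by (metis (no_types, lifting))
    \<comment> \<open>The dual vectors are the columns of \<open>V\<close>. As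
      \<open>n < card J\<close>, this matrix is wide, and its kernel vector \<open>w\<close> is a
      linear dependency among them.\<close>
    define V where "V = mat_of_cols n (map (\<lambda>i. d (pick J i)) [0..<card J])"
    have V: "V \<in> carrier_mat n (card J)" by (auto simp: V_def)
    obtain w where w: "w \<in> carrier_vec (card J)" "w \<noteq> 0\<^sub>v (card J)" "V *\<^sub>v w = 0\<^sub>v n"
      using wide_matrix_kernel[OF V less] by blast
    have "w $ i = 0" if i: "i < card J" for i
    proof -
      have Ji: "pick J l \<in> J" if "l < card J" for l
        using pick_in_set_le that by blast
      have inj: "pick J l \<noteq> pick J i" if "l < card J" "l \<noteq> i" for l
        using pick_mono_le[of _ J] that i by (metis nat_neq_iff)
      have m: "pick J i < m" using Ji[OF i] J(1) by auto
      have cV: "col V l = d (pick J l)" if "l < card J" for l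
        using that d Ji[OF that] by (simp add: V_def)
      \<comment> \<open>Applying row \<open>pick J i\<close> of \<open>A\<close> to the dependency
        leaves only the term at \<open>i\<close>, by duality. Its coefficient is nonzero, so
        \<open>w $ i\<close> vanishes, against the choice of \<open>w\<close>.\<close>
      have "0 = (A * V *\<^sub>v w) $ pick J i"
        using A V w m by (simp add: assoc_mult_mat_vec[OF A V w(1)])
      also have "\<dots> = (\<Sum>l = 0..<card J. (row A (pick J i) \<bullet> d (pick J l)) * w $ l)"
        using A V w m by (simp add: scalar_prod_def[of "row (A * V) _"] cV del: row_mult assoc_mult_mat_vec)
      also have "\<dots> = (\<Sum>l = 0..<card J. if l = i then (row A (pick J i) \<bullet> d (pick J i)) * w $ i else 0)"
      proof (intro sum.cong refl)
        fix l assume "l \<in> {0..<card J}"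
        hence "row A (pick J i) \<bullet> d (pick J l) = 0" if "l \<noteq> i"
          using d Ji[OF i] Ji[of l] inj[of l] that by simp
        thus "row A (pick J i) \<bullet> d (pick J l) * w $ l =
            (if l = i then row A (pick J i) \<bullet> d (pick J i) * w $ i else 0)"
          by auto
      qed
      also have "\<dots> = (row A (pick J i) \<bullet> d (pick J i)) * w $ i"
        using i by simp
      finally show ?thesis using d Ji[OF i] by simp
    qed
    thus False using w by (auto simp: vec_eq_iff)
  qed
  ultimately show thesis using that J by force
qed

lemma rows_separate_mono:
  "rows_separate A I \<Longrightarrow> I \<subseteq> J \<Longrightarrow> rows_separate A J"
  by (auto simp: rows_separate_def)

lemma rows_separate_iff_kernel:
  assumes A: "A \<in> carrier_mat m n"
  shows "rows_separate A {..<m} \<longleftrightarrow> (\<forall>v\<in>carrier_vec n. A *\<^sub>v v = 0\<^sub>v m \<longrightarrow> v = 0\<^sub>v n)"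
  using A by (auto simp: rows_separate_def vec_eq_iff)

text \<open>A nonzero minor of order \<open>n\<close> bounds the rank from below, the number of
  columns from above. This selects the nontrivial branch of \<open>principal_perm\<close>.\<close>

lemma rows_separate_imp_full_column_rank:
  assumes A: "A \<in> carrier_mat m n" and sep: "rows_separate A {..<m}"
  shows "full_column_rank A"
proof -
  obtain I where I: "I \<subseteq> {..<m}" "card I = n" "rows_separate A I"
    using rows_separate_imp_minor[OF A sep] .
  hence "n \<le> vec_space.rank m A"
    using vec_space.rank_gt_minor[OF A, of I UNIV] det_submatrix_nonzero_iff[OF A] by simp
  thus ?thesis
    using vec_space.rank_le_nc[OF A] A by (simp add: full_column_rank_def)
qed

lemma nonsing_perms_nonempty:
  assumes A: "A \<in> carrier_mat m n" and "n \<le> m" and sep: "rows_separate A {..<m}"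
  shows "nonsing_perms A \<noteq> {}"
proof -
  obtain I where I: "I \<subseteq> {..<m}" "card I = n" "rows_separate A I"
    using rows_separate_imp_minor[OF A sep] .
  obtain \<sigma> where "\<sigma> permutes {..<m}" "inv_into UNIV \<sigma> ` {..<n} = I"
    using permutes_inv_image_eq[OF I(1,2)] .
  hence "\<sigma> \<in> nonsing_perms A"
    using I(3) A det_perm_submatrix_nonzero_iff[OF A \<open>n \<le> m\<close>] by (simp add: nonsing_perms_def)
  thus ?thesis by blast
qed

section \<open>The order on permutations and the principal permutation\<close>

text \<open>The larger of the two deciding positions decides the combined comparison, since all
  three maps agree beyond it.\<close>

lemma perm_less_trans:
  assumes "perm_less m \<rho> \<sigma>" "perm_less m \<sigma> \<tau>"
  shows "perm_less m \<rho> \<tau>"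
proof -
  obtain s where s: "s < m" "\<rho> s < \<sigma> s" "\<And>j. s < j \<Longrightarrow> j < m \<Longrightarrow> \<sigma> j = \<rho> j"
    using assms(1) by (auto simp: perm_less_def)
  obtain t where t: "t < m" "\<sigma> t < \<tau> t" "\<And>j. t < j \<Longrightarrow> j < m \<Longrightarrow> \<tau> j = \<sigma> j"
    using assms(2) by (auto simp: perm_less_def)
  have "\<rho> (max s t) < \<tau> (max s t)"
    using s t by (cases s t rule: linorder_cases) (auto simp: max_def)
  moreover have "\<tau> j = \<rho> j" if "max s t < j" "j < m" for j
    using s(3) t(3) that by simp
  ultimately show ?thesis
    using s(1) t(1) unfolding perm_less_def by (intro exI[of _ "max s t"]) simp
qed

lemma perm_less_asym:
  assumes "perm_less m \<sigma> \<tau>"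
  shows "\<not> perm_less m \<tau> \<sigma>"
proof
  assume "perm_less m \<tau> \<sigma>"
  with assms have "perm_less m \<sigma> \<sigma>" by (rule perm_less_trans)
  thus False by (simp add: perm_less_def)
qed

text \<open>The largest position where the two permutations differ decides. One exists below
  \<open>m\<close> because both fix every point outside \<open>{..<m}\<close>.\<close>

lemma perm_less_total:
  assumes "\<sigma> permutes {..<m}" "\<tau> permutes {..<m}" "\<sigma> \<noteq> \<tau>"
  shows "perm_less m \<sigma> \<tau> \<or> perm_less m \<tau> \<sigma>"
proof -
  define D where "D = {i. i < m \<and> \<sigma> i \<noteq> \<tau> i}"
  have "D \<noteq> {}"
    using assms by (auto simp: D_def fun_eq_iff permutes_def) (metis lessThan_iff)
  moreover have fin: "finite D" by (simp add: D_def)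
  ultimately have "Max D \<in> D" by (intro Max_in)
  then obtain t where t: "t < m" "\<sigma> t \<noteq> \<tau> t" and max: "t = Max D"
    by (simp add: D_def)
  have eq: "\<forall>j. t < j \<and> j < m \<longrightarrow> \<sigma> j = \<tau> j"
    using Max_ge[OF fin] unfolding max[symmetric] by (force simp: D_def)
  consider "\<sigma> t < \<tau> t" | "\<tau> t < \<sigma> t"
    using t(2) by linarith
  thus ?thesis
    by cases (use t(1) eq in \<open>auto simp: perm_less_def\<close>)
qed

text \<open>Justifies the description operator: a finite nonempty set with a strict total order has
  exactly one greatest element.\<close>

lemma principal_perm_nonsing:
  assumes rank: "full_column_rank A" and ne: "nonsing_perms A \<noteq> {}"
  shows "principal_perm A \<in> nonsing_perms A"
proof -
  let ?m = "dim_row A"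
  let ?max = "\<lambda>\<sigma>. \<sigma> \<in> nonsing_perms A \<and>
              (\<forall>\<tau>\<in>nonsing_perms A. \<tau> \<noteq> \<sigma> \<longrightarrow> perm_less ?m \<tau> \<sigma>)"
  have "finite (nonsing_perms A)"
    by (rule finite_subset[OF _ finite_permutations[of "{..<?m}"]]) (auto simp: nonsing_perms_def)
  moreover have "asymp_on (nonsing_perms A) (perm_less ?m)"
    by (rule asymp_onI) (rule perm_less_asym)
  moreover have "transp_on (nonsing_perms A) (perm_less ?m)"
    by (rule transp_onI) (rule perm_less_trans)
  ultimately obtain \<sigma> where \<sigma>: "\<sigma> \<in> nonsing_perms A"
    "\<forall>\<tau>\<in>nonsing_perms A. \<tau> \<noteq> \<sigma> \<longrightarrow> \<not> perm_less ?m \<sigma> \<tau>"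
    using Finite_Set.bex_max_element[OF _ _ _ ne] by metis
  \<comment> \<open>Totality turns the maximal element into a greatest one.\<close>
  have "?max \<sigma>"
    using \<sigma> perm_less_total unfolding nonsing_perms_def by blast
  moreover have "\<tau> = \<sigma>" if "?max \<tau>" for \<tau>
  proof (rule ccontr)
    assume "\<tau> \<noteq> \<sigma>"
    hence "perm_less ?m \<tau> \<sigma>" "perm_less ?m \<sigma> \<tau>"
      using that \<open>?max \<sigma>\<close> by simp_all
    thus False using perm_less_asym by blast
  qed
  ultimately have "?max (THE \<sigma>. ?max \<sigma>)"
    by (rule theI)
  thus ?thesis using rank by (simp add: principal_perm_def)
qed

section \<open>Nonvanishing of the generalized determinant\<close>

text \<open>A sum of real squares is nonzero iff some term is, and a nonzero minor amounts to
  \<open>n\<close> separating rows, which can be extracted from all rows whenever these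
  separate.\<close>

lemma minor_square_sum_nonzero_iff:
  assumes A: "A \<in> carrier_mat m n"
  shows "(\<Sum>I | I \<subseteq> {..<m} \<and> card I = n. (det (submatrix A I UNIV))\<^sup>2 :: real) \<noteq> 0
    \<longleftrightarrow> rows_separate A {..<m}"
proof -
  let ?sum = "\<Sum>I | I \<subseteq> {..<m} \<and> card I = n. (det (submatrix A I UNIV))\<^sup>2"
  have "finite {I. I \<subseteq> {..<m} \<and> card I = n}" by simp
  hence "?sum \<noteq> 0 \<longleftrightarrow> (\<exists>I. I \<subseteq> {..<m} \<and> card I = n \<and> det (submatrix A I UNIV) \<noteq> 0)"
    by (subst sum_nonneg_eq_0_iff) auto
  also have "\<dots> \<longleftrightarrow> (\<exists>I. I \<subseteq> {..<m} \<and> card I = n \<and> rows_separate A I)"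
    using det_submatrix_nonzero_iff[OF A] by blast
  also have "\<dots> \<longleftrightarrow> rows_separate A {..<m}"
  proof
    assume "\<exists>I. I \<subseteq> {..<m} \<and> card I = n \<and> rows_separate A I"
    thus "rows_separate A {..<m}" using rows_separate_mono by blast
  next
    assume "rows_separate A {..<m}"
    from rows_separate_imp_minor[OF A this]
    show "\<exists>I. I \<subseteq> {..<m} \<and> card I = n \<and> rows_separate A I" by blast
  qed
  finally show ?thesis .
qed

lemma Gdet_eq:
  assumes "A \<in> carrier_mat m n"
  shows "Gdet A = mat_sign A *
     sqrt (\<Sum>I | I \<subseteq> {..<m} \<and> card I = n. (det (submatrix A I UNIV))\<^sup>2)"
  using assms by (simp add: Gdet_def)

text \<open>The square root already detects separation. It remains to see that the sign does not
  vanish when the rows separate: the principal permutation is then a nonsingular one.\<close>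

lemma Gdet_nonzero_iff:
  assumes A: "A \<in> carrier_mat m n" and "n \<le> m"
  shows "Gdet A \<noteq> 0 \<longleftrightarrow> rows_separate A {..<m}"
proof -
  have "mat_sign A \<noteq> 0" if "rows_separate A {..<m}"
    using principal_perm_nonsing[OF rows_separate_imp_full_column_rank[OF A that]
        nonsing_perms_nonempty[OF A \<open>n \<le> m\<close> that]]
    by (simp add: mat_sign_def principal_submatrix_def nonsing_perms_def sgn_zero_iff)
  thus ?thesis
    unfolding Gdet_eq[OF A] mult_eq_0_iff real_sqrt_eq_0_iff
    using minor_square_sum_nonzero_iff[OF A] by blast
qed

section \<open>Multiplicativity under right multiplication by a square matrix\<close>

lemma Gdet_mult:
  assumes A: "A \<in> carrier_mat m n" and "n \<le> m" and B: "B \<in> carrier_mat n n"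
  shows "Gdet (A * B) = Gdet A * det B"
proof -
  have AB: "A * B \<in> carrier_mat m n" using A B by simp
  define S where "S M = (\<Sum>I | I \<subseteq> {..<m} \<and> card I = n. (det (submatrix M I UNIV))\<^sup>2)"
    for M :: "real mat"
  have "(det (submatrix (A * B) I UNIV))\<^sup>2 = (det (submatrix A I UNIV))\<^sup>2 * (det B)\<^sup>2"
    if "I \<subseteq> {..<m}" "card I = n" for I
    using submatrix_rows_mult[OF A B that(1)] det_mult[OF submatrix_rows_carrier[OF A that] B]
    by (simp add: power_mult_distrib)
  hence S: "S (A * B) = S A * (det B)\<^sup>2"
    by (simp add: S_def sum_distrib_right)
  have perm: "det (perm_submatrix \<sigma> (A * B)) = det (perm_submatrix \<sigma> A) * det B" for \<sigma>
    using perm_submatrix_mult[OF A B] det_mult[OF perm_submatrix_carrier[OF A] B] by simp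
  have G: "Gdet M = mat_sign M * sqrt (S M)" if "M \<in> carrier_mat m n" for M
    using Gdet_eq[OF that] by (simp add: S_def)
  show ?thesis
  proof (cases "det B = 0 \<or> S A = 0")
    \<comment> \<open>The square root vanishes on both sides or \<open>det B\<close> does, so the
      signs, and with them the principal permutations, need not be compared.\<close>
    case True
    thus ?thesis using S by (auto simp: G[OF A] G[OF AB])
  next
    case False
    hence "rows_separate A {..<m}" "rows_separate (A * B) {..<m}"
      using minor_square_sum_nonzero_iff[OF A] minor_square_sum_nonzero_iff[OF AB] S
      by (auto simp: S_def)
    hence "full_column_rank A" "full_column_rank (A * B)"
      using rows_separate_imp_full_column_rank A AB by blast+
    \<comment> \<open>Every candidate determinant is scaled by the same nonzero factor
      \<open>det B\<close>, so the maximum is taken over the same set.\<close>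
    moreover have "nonsing_perms (A * B) = nonsing_perms A"
      using False A B by (auto simp: nonsing_perms_def perm)
    ultimately have "principal_perm (A * B) = principal_perm A"
      using A B by (simp add: principal_perm_def)
    hence "mat_sign (A * B) = mat_sign A * sgn (det B)"
      by (simp add: mat_sign_def principal_submatrix_def perm sgn_mult)
    \<comment> \<open>The root contributes the absolute value of \<open>det B\<close> and the sign
      factor its sign; together they restore \<open>det B\<close>.\<close>
    hence "Gdet (A * B) = (mat_sign A * sqrt (S A)) * (sgn (det B) * \<bar>det B\<bar>)"
      by (simp add: G[OF AB] S real_sqrt_mult)
    thus ?thesis
      by (simp only: G[OF A] sgn_mult_abs)
  qed
qed

section \<open>Cramer's rule and uniqueness of the solution\<close>

text \<open>Compare columns: \<open>A\<close> sends the replaced column \<open>x\<close> to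
  \<open>A *\<^sub>v x\<close> and each remaining unit vector to the corresponding column of
  \<open>A\<close>.\<close>

lemma replace_col_mult_vec:
  fixes A :: "'a :: comm_semiring_1 mat"
  assumes A: "A \<in> carrier_mat m n" and x: "x \<in> carrier_vec n"
  shows "replace_col A (A *\<^sub>v x) i = A * replace_col (1\<^sub>m n) x i"
proof (rule eq_matI)
  fix k j assume "k < dim_row (A * replace_col (1\<^sub>m n) x i)"
    "j < dim_col (A * replace_col (1\<^sub>m n) x i)"
  hence kj: "k < m" "j < n" using A by (auto simp: replace_col_def)
  have "col (replace_col (1\<^sub>m n) x i) j = (if j = i then x else unit_vec n j)"
    using x kj by (auto simp: replace_col_def intro!: eq_vecI)
  thus "replace_col A (A *\<^sub>v x) i $$ (k, j) = (A * replace_col (1\<^sub>m n) x i) $$ (k, j)"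
    using A x kj by (auto simp: replace_col_def)
qed (use A in \<open>auto simp: replace_col_def\<close>)

lemma Gdet_replace_col:
  assumes A: "A \<in> carrier_mat m n" and "n \<le> m" and x: "x \<in> carrier_vec n" and i: "i < n"
  shows "Gdet (replace_col A (A *\<^sub>v x) i) = x $ i * Gdet A"
proof -
  have "replace_col (1\<^sub>m n) x i \<in> carrier_mat n n"
    by (auto simp: replace_col_def)
  \<comment> \<open>The square Cramer lemma, applied to the identity matrix.\<close>
  moreover have "det (replace_col (1\<^sub>m n) x i) = x $ i"
    using cramer_lemma_mat[OF one_carrier_mat x i] x by simp
  ultimately show ?thesis
    using Gdet_mult[OF A \<open>n \<le> m\<close>] replace_col_mult_vec[OF A x] by simp
qed

text \<open>The solutions form the coset of the kernel through the given \<open>x\<close>, so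
  uniqueness means that the kernel is trivial.\<close>

lemma ex1_solution_iff_kernel:
  fixes A :: "'a :: ring mat"
  assumes A: "A \<in> carrier_mat m n" and x: "x \<in> carrier_vec n" "A *\<^sub>v x = b"
  shows "(\<exists>!x. x \<in> carrier_vec n \<and> A *\<^sub>v x = b) \<longleftrightarrow>
    (\<forall>v\<in>carrier_vec n. A *\<^sub>v v = 0\<^sub>v m \<longrightarrow> v = 0\<^sub>v n)"
proof (intro iffI ballI impI)
  fix v assume uniq: "\<exists>!x. x \<in> carrier_vec n \<and> A *\<^sub>v x = b"
    and v: "v \<in> carrier_vec n" "A *\<^sub>v v = 0\<^sub>v m"
  have "A *\<^sub>v (x + v) = b"
    using mult_add_distrib_mat_vec[OF A x(1) v(1)] A x v by auto
  hence eq: "x + v = x"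
    using uniq x add_carrier_vec[OF x(1) v(1)] by blast
  have "v $ i = 0" if "i < n" for i
    using arg_cong[OF eq, of "\<lambda>w. w $ i"] x v that by simp
  thus "v = 0\<^sub>v n" using v by auto
next
  assume inj: "\<forall>v\<in>carrier_vec n. A *\<^sub>v v = 0\<^sub>v m \<longrightarrow> v = 0\<^sub>v n"
  show "\<exists>!x. x \<in> carrier_vec n \<and> A *\<^sub>v x = b"
  proof (rule ex1I[of _ x])
    fix y assume y: "y \<in> carrier_vec n \<and> A *\<^sub>v y = b"
    hence "A *\<^sub>v (y - x) = 0\<^sub>v m"
      using mult_minus_distrib_mat_vec[OF A _ x(1), of y] A x by auto
    hence eq: "y - x = 0\<^sub>v n" using inj x y by auto
    have "y $ i = x $ i" if "i < n" for i
      using arg_cong[OF eq, of "\<lambda>w. w $ i"] x y that by simp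
    thus "y = x" using x y by auto
  qed (use x in simp)
qed

theorem theorem4p1:
  fixes A :: "real mat" and b :: "real vec" and m n :: nat
  assumes "1 \<le> n" and "n \<le> m"
    and "A \<in> carrier_mat m n"
    and "b \<in> carrier_vec m"
    and "b \<in> vec_space.col_space m A"
  shows "((\<exists>!x. x \<in> carrier_vec n \<and> A *\<^sub>v x = b) \<longleftrightarrow> Gdet A \<noteq> 0) \<and>
    (Gdet A \<noteq> 0 \<longrightarrow>
      (\<forall>x\<in>carrier_vec n. A *\<^sub>v x = b \<longrightarrow>
        (\<forall>i<n. x $ i = Gdet (replace_col A b i) / Gdet A)))"
proof -
  note A = assms(3)
  \<comment> \<open>Membership of \<open>b\<close> in the column space supplies the particular
    solution from which the coset argument starts.\<close>
  obtain x where "x \<in> carrier_vec n" "A *\<^sub>v x = b"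
    using assms(5) A by (auto simp: vec_space.col_space_eq[OF A])
  hence "(\<exists>!x. x \<in> carrier_vec n \<and> A *\<^sub>v x = b) \<longleftrightarrow> Gdet A \<noteq> 0"
    using ex1_solution_iff_kernel[OF A] rows_separate_iff_kernel[OF A]
      Gdet_nonzero_iff[OF A assms(2)] by simp
  moreover have "x $ i = Gdet (replace_col A b i) / Gdet A"
    if "Gdet A \<noteq> 0" "x \<in> carrier_vec n" "A *\<^sub>v x = b" "i < n" for x i
    using Gdet_replace_col[OF A assms(2) that(2,4)] that(1,3) by simp
  ultimately show ?thesis by blast
qed

end
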